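(* Let $G$ be an unweighted graph with $n=|V(G)|\ge2$ and let $k<|E(G)|$ be an integer. Then $\gamma'_R(G)\le k$ if and only if there exists a polynomial $$p\in\left\{q\in s\bigl(I(G)*C(0,-1,y)*R[x]\bigr)\;\middle|\;|E(G)|+\frac{q(1,1)}{2n-4+i}\le k\right\}$$ such that $\mathrm{coef}_{x^j}(p)\notin -i+\mathbb{Z}$ for all $j\in\left\{0,\dots,\binom{n}{2}-1\right\}$.
   Context: Graphs are finite and simple; $i$ is the imaginary unit. An edge Roman dominating function of $G$ is a function $f\colon E(G)\to\{0,1,2\}$ such that every edge $e$ with $f(e)=0$ is adjacent to (shares exactly one vertex with) some edge $e'$ with $f(e')=2$. Its weight is $w(f)=\sum_{e\in E(G)}f(e)$, and $\gamma'_R(G)$ is the minimum weight of an edge Roman dominating function of $G$. For a commutative ring $R$, an $R$-weighted complete graph $G$ is a complete graph on a finite vertex set $V(G)$ with a weight function $\nu_G$ from the set of all 2-element subsets of $V(G)$ to $R$. Weights in a subring are regarded as weights in the larger ring; here everything may be taken over $\mathbb{C}[x,y]$. If $H,G$ are $R$-weighted complete graphs with $|V(H)|=|V(G)|$ and $f\colon V(H)\to V(G)$ is a bijection, $H*_fG$ is the $R$-weighted complete graph on $V(H)$ with $\nu_{H*_fG}(e)=\nu_H(e)\cdot\nu_G(f(e))$, where $f(\{a,b\})=\{f(a),f(b)\}$. Put $H*G=\{H*_fG : f\colon V(H)\to V(G)\text{ a bijection}\}$, and for families $\mathscr{H},\mathscr{G}$ of $R$-weighted complete graphs of the same order $\mathscr{H}*\mathscr{G}=\bigcup_{H\in\mathscr{H},\,G\in\mathscr{G}}H*G$.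 A single graph is identified with the corresponding singleton. The operation $*$ on families is associative. For an $R$-weighted complete graph $G$, $s(G)=\sum_e\nu_G(e)$ (sum over all 2-element subsets $e$ of $V(G)$), and $s(\mathscr{G})=\{s(G):G\in\mathscr{G}\}$. Weighted complete graphs on the same vertex set are added and multiplied by scalars edgewise. For an unweighted graph $G$, $I(G)$ is the weighted complete graph on $V(G)$ with weight $1$ on edges of $G$ and $0$ on non-edges. $E(1,2)$ is the graph on $\{1,\dots,n\}$ whose only edge is $\{1,2\}$, and $C(0,-1,y)$ is the family of all $\mathbb{Z}[y]$-weighted complete graphs $H$ of order $n$ with $s(H*I(E(1,2)))\subseteq\{0,-1,y\}$ (that is, all weights of $H$ lie in $\{0,-1,y\}$). For $1\le j<k\le n$, $R(j,k)$ is the $\mathbb{C}$-weighted complete graph on $\{1,\dots,n\}$ with $\nu_{R(j,k)}(\{v,u\})$ equal to $i$ if $\{v,u\}=\{j,k\}$, to $1$ if $|\{j,k\}\cap\{v,u\}|=1$, and to $0$ otherwise. Then $R[x]=\sum_{1\le j<k\le n}x^{\psi(k,j)}\cdot R(j,k)$, where $\psi(k,j)=\binom{k-1}{2}+j-1$ for $k>j$ enumerates the pairs by $0,\dots,\binom n2-1$. For $q\in\mathbb{C}[x,y]$, $q(1,1)$ is the value at $x=y=1$ and $\mathrm{coef}_{x^j}(q)\in\mathbb{C}[y]$ is the coefficient of $x^j$. The set $-i+\mathbb{Z}$ consists of the constants $-i+m$, $m\in\mathbb{Z}$. An inequality $z\le k$ for a complex number $z$ means that $z$ is real and $z\le k$.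 *)

theory Defs
  imports Complex_Main "HOL-Library.Ramsey" "HOL-Computational_Algebra.Polynomial"
begin

definition simple_graph :: "'v set \<Rightarrow> 'v set set \<Rightarrow> bool" where
  "simple_graph V E \<longleftrightarrow> finite V \<and> E \<subseteq> [V]\<^bsup>2\<^esup>"

definition adjacent_edges :: "'v set \<Rightarrow> 'v set \<Rightarrow> bool" where
  "adjacent_edges e e' \<longleftrightarrow> card (e \<inter> e') = 1"

definition edge_roman_dom :: "'v set set \<Rightarrow> ('v set \<Rightarrow> nat) \<Rightarrow> bool" where
  "edge_roman_dom E f \<longleftrightarrow>
     f ` E \<subseteq> {0, 1, 2} \<and>
     (\<forall>e\<in>E. f e = 0 \<longrightarrow> (\<exists>e'\<in>E. adjacent_edges e e' \<and> f e' = 2))"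

text \<open>The minimum is taken over a nonempty set, since the constant function 1 qualifies.\<close>

definition edge_roman_number :: "'v set set \<Rightarrow> nat" where
  "edge_roman_number E = (LEAST w. \<exists>f. edge_roman_dom E f \<and> w = (\<Sum>e\<in>E. f e))"

datatype ('v, 'r) wgraph = WGraph (verts: "'v set") (weight: "'v set \<Rightarrow> 'r")

text \<open>
  A weight function lives on the 2-element sets of vertices; as a total function it is required
  to vanish elsewhere, so that equality of weighted graphs is the intended one.
\<close>

definition weighted_complete_graph :: "('v, 'r::comm_ring_1) wgraph \<Rightarrow> bool" where
  "weighted_complete_graph G \<longleftrightarrow>
     finite (verts G) \<and> (\<forall>e. e \<notin> [verts G]\<^bsup>2\<^esup> \<longrightarrow> weight G e = 0)"

definition map_weights :: "('r \<Rightarrow> 's) \<Rightarrow> ('v, 'r) wgraph \<Rightarrow> ('v, 's) wgraph" where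
  "map_weights h G = WGraph (verts G) (\<lambda>e. h (weight G e))"

definition wprod_by ::
    "('v \<Rightarrow> 'w) \<Rightarrow> ('v, 'r::comm_ring_1) wgraph \<Rightarrow> ('w, 'r) wgraph \<Rightarrow> ('v, 'r) wgraph" where
  "wprod_by f H G = WGraph (verts H) (\<lambda>e. weight H e * weight G (f ` e))"

definition wprod ::
    "('v, 'r::comm_ring_1) wgraph \<Rightarrow> ('w, 'r) wgraph \<Rightarrow> ('v, 'r) wgraph set" where
  "wprod H G = {wprod_by f H G | f. bij_betw f (verts H) (verts G)}"

definition fam_prod ::
    "('v, 'r::comm_ring_1) wgraph set \<Rightarrow> ('w, 'r) wgraph set \<Rightarrow> ('v, 'r) wgraph set"
    (infixl \<open>\<star>\<close> 70) where
  "\<H> \<star> \<G> = (\<Union>H\<in>\<H>. \<Union>G\<in>\<G>. wprod H G)"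

definition total_weight :: "('v, 'r::comm_ring_1) wgraph \<Rightarrow> 'r" where
  "total_weight G = (\<Sum>e\<in>[verts G]\<^bsup>2\<^esup>. weight G e)"

definition wscale :: "'r::comm_ring_1 \<Rightarrow> ('v, 'r) wgraph \<Rightarrow> ('v, 'r) wgraph" where
  "wscale c G = WGraph (verts G) (\<lambda>e. c * weight G e)"

text \<open>Edgewise sum of weighted complete graphs on the common vertex set \<open>V\<close>.\<close>

definition wsum :: "'v set \<Rightarrow> 'i set \<Rightarrow> ('i \<Rightarrow> ('v, 'r::comm_ring_1) wgraph) \<Rightarrow> ('v, 'r) wgraph" where
  "wsum V I F = WGraph V (\<lambda>e. \<Sum>i\<in>I. weight (F i) e)"

definition indicator_graph :: "'v set \<Rightarrow> 'v set set \<Rightarrow> ('v, 'r::comm_ring_1) wgraph" where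
  "indicator_graph V E = WGraph V (\<lambda>e. if e \<in> E then 1 else 0)"

text \<open>
  The ring $\mathbb{C}[x,y] = \mathbb{C}[y][x]$ is \<open>complex poly poly\<close>: the outer variable is \<open>x\<close>,
  the inner one is \<open>y\<close>. Hence \<open>coeff q j\<close> is the coefficient of \<open>x ^ j\<close> in \<open>q\<close>,
  an element of $\mathbb{C}[y]$.
\<close>

definition of_Zy :: "int poly \<Rightarrow> complex poly poly" where
  "of_Zy p = [:map_poly of_int p:]"

definition of_C :: "complex \<Rightarrow> complex poly poly" where
  "of_C c = [:[:c:]:]"

definition eval11 :: "complex poly poly \<Rightarrow> complex" where
  "eval11 q = poly (poly q 1) 1"

text \<open>
  The family $C(0,-1,y)$ of $\mathbb{Z}[y]$-weighted complete graphs of order \<open>n\<close>; the vertex sets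
  range over all \<open>n\<close>-element sets of naturals, and \<open>[:0, 1:]\<close> is the variable \<open>y\<close>.
\<close>

definition C_fam :: "nat \<Rightarrow> (nat, int poly) wgraph set" where
  "C_fam n = {H. weighted_complete_graph H \<and> card (verts H) = n \<and>
     total_weight ` ({H} \<star> {indicator_graph {1..n} {{1, 2}}}) \<subseteq> {0, -1, [:0, 1:]}}"

definition R_graph :: "nat \<Rightarrow> nat \<Rightarrow> nat \<Rightarrow> (nat, complex) wgraph" where
  "R_graph n j k = WGraph {1..n}
     (\<lambda>e. if e = {j, k} then \<i>
          else if e \<in> [{1..n}]\<^bsup>2\<^esup> \<and> card ({j, k} \<inter> e) = 1 then 1 else 0)"

definition pair_index :: "nat \<Rightarrow> nat \<Rightarrow> nat" where
  "pair_index k j = ((k - 1) choose 2) + j - 1"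

definition R_poly :: "nat \<Rightarrow> (nat, complex poly poly) wgraph" where
  "R_poly n = wsum {1..n} {(j, k). 1 \<le> j \<and> j < k \<and> k \<le> n}
     (\<lambda>(j, k). wscale (monom 1 (pair_index k j)) (map_weights of_C (R_graph n j k)))"

text \<open>Elements of $-i+\mathbb{Z}$ as constant polynomials in \<open>y\<close>.\<close>

definition minus_i_plus_Z :: "complex poly set" where
  "minus_i_plus_Z = {[:- \<i> + of_int m:] | m. True}"

definition complex_le :: "complex \<Rightarrow> int \<Rightarrow> bool" where
  "complex_le z k \<longleftrightarrow> z \<in> \<real> \<and> Re z \<le> of_int k"

end

theory Submission
  imports Defs
begin

text \<open>
  The polynomials in the family are encodings of labellings of the edges of the given graph by
  \<open>{0, 1, 2}\<close>. Multiplying the indicator graph by a member of $C(0,-1,y)$ puts an arbitrary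
  weight from $\{0,-1,y\}$ on each edge and erases the non-edges; read $-1$ as label $0$, the
  weight $0$ as label $1$, and $y$ as label $2$. Since these weights are arbitrary, the bijection
  onto the vertices of that member can be absorbed into the labelling, and only the bijection \<open>g\<close>
  onto the vertices of $R[x]$ remains (\<open>total_weight_family\<close>). So the theorem compares, labelling by
  labelling, two conditions on the polynomial with the two conditions ``weight at most \<open>k\<close>'' and
  ``edge Roman dominating''.

  For the weight: at $x=y=1$ a label \<open>m\<close> becomes $m-1$, and it is multiplied by the value at $x=1$
  of the weight of $R[x]$ on that edge. The latter is the same for every edge: an edge of the
  complete graph meets $2(n-2)$ other edges in one vertex, and counts \<open>\<i>\<close> for itself. Dividing by
  $2n-4+i$ therefore returns the sum of the $m-1$, that is, the weight minus the number of edges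
  (\<open>card_plus_eval11_label_sum\<close>).

  For domination: the powers of \<open>x\<close> separate the pairs of vertices, because the pair index is a
  bijection. The coefficient belonging to a pair \<open>b\<close> is \<open>\<i>\<close> times the weight of \<open>b\<close> plus the sum of
  the weights of the edges adjacent to \<open>b\<close>. Its constant term has imaginary part $-1$ exactly
  if \<open>b\<close> is an edge with label $0$, and in that case its coefficient of \<open>y\<close> is the number of
  adjacent edges with label $2$. So the coefficient lies in $-i+\mathbb{Z}$ exactly when \<open>b\<close> is
  an edge violating the domination condition (\<open>label_combination_mem_iff\<close>).
\<close>

section \<open>Pairs of vertices\<close>

definition ordered_pairs :: "nat \<Rightarrow> (nat \<times> nat) set" where
  "ordered_pairs n = {(j, k). 1 \<le> j \<and> j < k \<and> k \<le> n}"

lemma finite_ordered_pairs: "finite (ordered_pairs n)"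
  by (rule finite_subset[of _ "{..n} \<times> {..n}"]) (auto simp: ordered_pairs_def)

lemma bij_betw_ordered_pairs:
  "bij_betw (\<lambda>(j, k). {j, k}) (ordered_pairs n) ([{1..n}]\<^bsup>2\<^esup>)"
proof (rule bij_betw_imageI)
  show "inj_on (\<lambda>(j, k). {j, k}) (ordered_pairs n)"
    by (auto simp: inj_on_def ordered_pairs_def doubleton_eq_iff)
  show "(\<lambda>(j, k). {j, k}) ` ordered_pairs n = [{1..n}]\<^bsup>2\<^esup>"
  proof (intro equalityI subsetI)
    fix d assume "d \<in> (\<lambda>(j, k). {j, k}) ` ordered_pairs n"
    then show "d \<in> [{1..n}]\<^bsup>2\<^esup>"
      by (auto simp: ordered_pairs_def nsets_def card_2_iff)
  next
    fix d assume "d \<in> [{1..n}]\<^bsup>2\<^esup>"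
    then obtain a b where ab: "d = {a, b}" "a \<noteq> b" "a \<in> {1..n}" "b \<in> {1..n}"
      by (auto simp: nsets_def card_2_iff)
    then have "(a, b) \<in> ordered_pairs n \<or> (b, a) \<in> ordered_pairs n"
      by (auto simp: ordered_pairs_def)
    then show "d \<in> (\<lambda>(j, k). {j, k}) ` ordered_pairs n"
      using ab(1) by (auto simp: image_iff insert_commute)
  qed
qed

lemma choose_two_step: "1 \<le> k \<Longrightarrow> k choose 2 = ((k - 1) choose 2) + (k - 1)"
  by (cases k) (simp_all add: numeral_2_eq_2)

text \<open>
  The pairs with larger element \<open>k\<close> occupy the block of $k-1$ consecutive numbers that starts at
  $\binom{k-1}{2}$, and this block ends where the block of $k+1$ starts. Hence the induction on \<open>n\<close>
  appends one block.
\<close>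

lemma bij_betw_pair_index:
  "bij_betw (\<lambda>(j, k). pair_index k j) (ordered_pairs n) {..<n choose 2}"
proof (induction n)
  case 0
  have "ordered_pairs 0 = {}" by (auto simp: ordered_pairs_def)
  then show ?case by (simp add: bij_betw_def numeral_2_eq_2)
next
  case (Suc n)
  have new: "bij_betw (\<lambda>(j, k). pair_index k j) ((\<lambda>j. (j, Suc n)) ` {1..n})
      {n choose 2..<Suc n choose 2}"
  proof (rule bij_betw_imageI)
    show "inj_on (\<lambda>(j, k). pair_index k j) ((\<lambda>j. (j, Suc n)) ` {1..n})"
      by (auto simp: inj_on_def pair_index_def)
    have "(\<lambda>(j, k). pair_index k j) ` (\<lambda>j. (j, Suc n)) ` {1..n}
        = (\<lambda>j. (n choose 2) + (j - 1)) ` {1..n}"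
      unfolding image_image by (rule image_cong) (auto simp: pair_index_def)
    also have "\<dots> = {n choose 2..<(n choose 2) + n}"
    proof (intro equalityI subsetI)
      fix m assume "m \<in> {n choose 2..<(n choose 2) + n}"
      then show "m \<in> (\<lambda>j. (n choose 2) + (j - 1)) ` {1..n}"
        by (intro image_eqI[where x = "m - (n choose 2) + 1"]) auto
    qed auto
    finally show "(\<lambda>(j, k). pair_index k j) ` (\<lambda>j. (j, Suc n)) ` {1..n}
        = {n choose 2..<Suc n choose 2}"
      using choose_two_step[of "Suc n"] by simp
  qed
  have "bij_betw (\<lambda>(j, k). pair_index k j) (ordered_pairs n \<union> (\<lambda>j. (j, Suc n)) ` {1..n})
      ({..<n choose 2} \<union> {n choose 2..<Suc n choose 2})"
    by (rule bij_betw_combine[OF Suc new]) auto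
  moreover have "ordered_pairs n \<union> (\<lambda>j. (j, Suc n)) ` {1..n} = ordered_pairs (Suc n)"
    by (auto simp: ordered_pairs_def)
  moreover have "{..<n choose 2} \<union> {n choose 2..<Suc n choose 2} = {..<Suc n choose 2}"
    using choose_two_step[of "Suc n"] by auto
  ultimately show ?case by simp
qed

text \<open>
  Such a pair is determined by its vertex inside \<open>e\<close> and its vertex outside \<open>e\<close>, which can be chosen
  independently.
\<close>

lemma card_pairs_meeting_once:
  assumes "finite N" "e \<in> [N]\<^bsup>2\<^esup>"
  shows "card {d \<in> [N]\<^bsup>2\<^esup>. card (d \<inter> e) = 1} = 2 * (card N - 2)"
proof -
  have e: "e \<subseteq> N" "finite e" "card e = 2"
    using assms(2) by (auto simp: nsets_def)
  have inj: "inj_on (\<lambda>(u, v). {u, v}) (e \<times> (N - e))"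
    by (auto simp: inj_on_def doubleton_eq_iff)
  have img: "(\<lambda>(u, v). {u, v}) ` (e \<times> (N - e)) = {d \<in> [N]\<^bsup>2\<^esup>. card (d \<inter> e) = 1}"
  proof (intro equalityI subsetI)
    fix d assume "d \<in> (\<lambda>(u, v). {u, v}) ` (e \<times> (N - e))"
    then obtain u v where uv: "d = {u, v}" "u \<in> e" "v \<in> N" "v \<notin> e"
      by auto
    then have "d \<inter> e = {u}" "u \<noteq> v" by auto
    then have "card (d \<inter> e) = 1" "card d = 2" using uv(1) by simp_all
    moreover have "d \<subseteq> N" "finite d" using uv e(1) by auto
    ultimately show "d \<in> {d \<in> [N]\<^bsup>2\<^esup>. card (d \<inter> e) = 1}"
      by (simp add: nsets_def)
  next
    fix d assume "d \<in> {d \<in> [N]\<^bsup>2\<^esup>. card (d \<inter> e) = 1}"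
    then have d: "d \<subseteq> N" "card d = 2" "card (d \<inter> e) = 1"
      by (auto simp: nsets_def)
    obtain a b where ab: "d = {a, b}" "a \<noteq> b" using d(2) by (meson card_2_iff)
    obtain u where "d \<inter> e = {u}" using d(3) by (meson card_1_singletonE)
    then have u: "x \<in> d \<and> x \<in> e \<longleftrightarrow> x = u" for x by blast
    consider "d = {a, b}" "a \<in> e" "b \<notin> e" | "d = {b, a}" "b \<in> e" "a \<notin> e"
      using u[of a] u[of b] u[of u] ab by auto
    then show "d \<in> (\<lambda>(u, v). {u, v}) ` (e \<times> (N - e))"
      using d(1) by cases auto
  qed
  have "card {d \<in> [N]\<^bsup>2\<^esup>. card (d \<inter> e) = 1} = card (e \<times> (N - e))"
    unfolding img[symmetric] by (rule card_image[OF inj])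
  then show ?thesis using e assms(1) by (simp add: card_cartesian_product card_Diff_subset)
qed

lemma bij_betw_nsets_image:
  assumes "bij_betw g A B" "e \<in> [A]\<^bsup>m\<^esup>"
  shows "g ` e \<in> [B]\<^bsup>m\<^esup>"
  using bij_betw_nsets[OF assms(1), of m] assms(2) by (auto simp: bij_betw_def)

lemma exists_bij_betw_doubleton:
  assumes "finite A" "finite B" "card A = card B" "{a, a'} \<subseteq> A" "a \<noteq> a'" "{b, b'} \<subseteq> B" "b \<noteq> b'"
  shows "\<exists>g. bij_betw g A B \<and> g ` {a, a'} = {b, b'}"
proof -
  have "card (A - {a, a'}) = card (B - {b, b'})"
    using assms by (simp add: card_Diff_subset)
  then obtain h where h: "bij_betw h (A - {a, a'}) (B - {b, b'})"
    using assms(1,2) by (meson finite_Diff finite_same_card_bij)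
  define g where "g v = (if v = a then b else if v = a' then b' else h v)" for v
  have "bij_betw g {a, a'} {b, b'}"
    using assms(5,7) by (auto simp: bij_betw_def g_def)
  moreover have "bij_betw g (A - {a, a'}) (B - {b, b'})"
    using h by (rule bij_betw_cong[THEN iffD1, rotated]) (auto simp: g_def)
  ultimately have "bij_betw g ({a, a'} \<union> (A - {a, a'})) ({b, b'} \<union> (B - {b, b'}))"
    by (rule bij_betw_combine) auto
  moreover have "{a, a'} \<union> (A - {a, a'}) = A" "{b, b'} \<union> (B - {b, b'}) = B"
    using assms(4,6) by auto
  moreover have "g ` {a, a'} = {b, b'}"
    using assms(5) by (auto simp: g_def)
  ultimately show ?thesis by metis
qed

section \<open>The families of weighted graphs\<close>

text \<open>
  Multiplying by a graph with a single edge picks out a single weight of \<open>H\<close>. This makes the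
  definition of $C(0,-1,y)$ by total weights a condition on the individual weights.
\<close>

lemma total_weight_indicator_doubleton:
  fixes H :: "('v, 'r::comm_ring_1) wgraph"
  assumes "finite (verts H)" "bij_betw g (verts H) B" "e \<in> [verts H]\<^bsup>2\<^esup>"
  shows "total_weight (wprod_by g H (indicator_graph B {g ` e})) = weight H e"
proof -
  have eq: "g ` d = g ` e \<longleftrightarrow> d = e" if "d \<in> [verts H]\<^bsup>2\<^esup>" for d
    using that assms(2,3) bij_betw_nsets[OF assms(2), of 2] by (auto simp: bij_betw_def inj_on_def)
  have "total_weight (wprod_by g H (indicator_graph B {g ` e}))
      = (\<Sum>d\<in>[verts H]\<^bsup>2\<^esup>. if d = e then weight H e else 0)"
    unfolding total_weight_def wprod_by_def indicator_graph_def
    by (simp, rule sum.cong) (auto simp: eq)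
  also have "\<dots> = weight H e"
    using assms(1,3) by (simp add: finite_imp_finite_nsets)
  finally show ?thesis .
qed

text \<open>
  A suitable bijection moves any prescribed pair to \<open>{1, 2}\<close>, so the total weights in the definition
  of the family run through all weights of \<open>H\<close>.
\<close>

lemma C_fam_iff:
  assumes "2 \<le> n"
  shows "H \<in> C_fam n \<longleftrightarrow> weighted_complete_graph H \<and> card (verts H) = n \<and>
    (\<forall>e\<in>[verts H]\<^bsup>2\<^esup>. weight H e \<in> {0, -1, [:0, 1:]})"
proof -
  have eq: "total_weight ` ({H} \<star> {indicator_graph {1..n} {{1, 2}}}) = weight H ` [verts H]\<^bsup>2\<^esup>"
    if H: "weighted_complete_graph H" "card (verts H) = n"
  proof (intro equalityI subsetI)
    have fin: "finite (verts H)" using H(1) by (simp add: weighted_complete_graph_def)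
    fix z assume "z \<in> total_weight ` ({H} \<star> {indicator_graph {1..n} {{1, 2}}})"
    then obtain g where g: "bij_betw g (verts H) {1..n}"
      and z: "z = total_weight (wprod_by g H (indicator_graph {1..n} {{1, 2}}))"
      by (auto simp: fam_prod_def wprod_def indicator_graph_def)
    have "{1, 2} \<in> [{1..n}]\<^bsup>2\<^esup>" using assms by (auto simp: nsets_def)
    then obtain e where e: "e \<in> [verts H]\<^bsup>2\<^esup>" "{1, 2} = g ` e"
      using bij_betw_nsets[OF g, of 2] by (metis bij_betw_imp_surj_on imageE)
    show "z \<in> weight H ` [verts H]\<^bsup>2\<^esup>"
      using total_weight_indicator_doubleton[OF fin g e(1)] e z by auto
  next
    have fin: "finite (verts H)" using H(1) by (simp add: weighted_complete_graph_def)
    fix z assume "z \<in> weight H ` [verts H]\<^bsup>2\<^esup>"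
    then obtain e where e: "e \<in> [verts H]\<^bsup>2\<^esup>" "z = weight H e" by auto
    then obtain a b where ab: "e = {a, b}" "a \<noteq> b" "{a, b} \<subseteq> verts H"
      by (auto simp: nsets_def card_2_iff)
    obtain g where g: "bij_betw g (verts H) {1..n}" "g ` e = {1, 2}"
      using exists_bij_betw_doubleton[of "verts H" "{1..n}" a b 1 2] fin H(2) ab assms by auto
    have "z = total_weight (wprod_by g H (indicator_graph {1..n} {{1, 2}}))"
      using total_weight_indicator_doubleton[OF fin g(1) e(1)] g(2) e(2) by simp
    then show "z \<in> total_weight ` ({H} \<star> {indicator_graph {1..n} {{1, 2}}})"
      using g(1) by (auto simp: fam_prod_def wprod_def indicator_graph_def)
  qed
  show ?thesis
  proof (cases "weighted_complete_graph H \<and> card (verts H) = n")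
    case True
    then show ?thesis
      unfolding C_fam_def mem_Collect_eq by (simp only: eq image_subset_iff)
  qed (auto simp: C_fam_def)
qed

text \<open>
  The value at $y=1$ is $m-1$ for every label \<open>m\<close>, while $y$ keeps the label $2$ visible in a sum of
  such weights, where the labels $0$ and $1$ contribute only to the constant term.
\<close>

definition label_poly :: "nat \<Rightarrow> int poly" where
  "label_poly m = (if m = 0 then -1 else if m = 2 then [:0, 1:] else 0)"

lemma label_poly_surj: "z \<in> {0, -1, [:0, 1:]} \<longleftrightarrow> (\<exists>m\<in>{0, 1, 2}. z = label_poly m)"
  by (auto simp: label_poly_def)

lemma label_poly_mem: "label_poly m \<in> {0, -1, [:0, 1:]}"
  by (simp add: label_poly_def)

lemma poly_label_poly_1: "m \<in> {0, 1, 2} \<Longrightarrow> poly (label_poly m) 1 = int m - 1"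
  by (auto simp: label_poly_def)

definition label_sum ::
    "'v set set \<Rightarrow> nat \<Rightarrow> ('v \<Rightarrow> nat) \<Rightarrow> ('v set \<Rightarrow> nat) \<Rightarrow> complex poly poly" where
  "label_sum E n g f = (\<Sum>e\<in>E. of_Zy (label_poly (f e)) * weight (R_poly n) (g ` e))"

lemma verts_simps:
  "verts (wprod_by f H G) = verts H"
  "verts (indicator_graph V E) = V"
  "verts (map_weights r G) = verts G"
  "verts (R_poly n) = {1..n}"
  by (simp_all add: wprod_by_def indicator_graph_def map_weights_def R_poly_def wsum_def)

lemma mem_fam_prod_iff:
  "M \<in> \<H> \<star> \<G> \<longleftrightarrow>
    (\<exists>H\<in>\<H>. \<exists>G\<in>\<G>. \<exists>f. bij_betw f (verts H) (verts G) \<and> M = wprod_by f H G)"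
  by (auto simp: fam_prod_def wprod_def)

lemma mem_fam_prodI:
  "H \<in> \<H> \<Longrightarrow> G \<in> \<G> \<Longrightarrow> bij_betw f (verts H) (verts G) \<Longrightarrow> wprod_by f H G \<in> \<H> \<star> \<G>"
  unfolding mem_fam_prod_iff by blast

text \<open>
  Given \<open>H\<close> and the bijection \<open>h\<close> onto its vertices, the labels are read off from the weights of \<open>H\<close> at
  the images of the edges. Conversely, a labelling is realised with \<open>h = g\<close>, by transporting it
  to \<open>{1..n}\<close>.
\<close>

lemma total_weight_family:
  assumes "simple_graph V E" "n = card V" "2 \<le> n"
  shows "total_weight ` ({indicator_graph V E} \<star> map_weights of_Zy ` C_fam n \<star> {R_poly n})
    = {label_sum E n g f | g f. bij_betw g V {1..n} \<and> f ` E \<subseteq> {0, 1, 2}}"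
    (is "?L = ?R")
proof -
  have fin: "finite V" and sub: "E \<subseteq> [V]\<^bsup>2\<^esup>"
    using assms(1) by (auto simp: simple_graph_def)
  have L: "q \<in> ?L \<longleftrightarrow> (\<exists>H\<in>C_fam n. \<exists>h g. bij_betw h V (verts H) \<and> bij_betw g V {1..n} \<and>
      q = total_weight
        (wprod_by g (wprod_by h (indicator_graph V E) (map_weights of_Zy H)) (R_poly n)))" for q
  proof
    assume "q \<in> ?L"
    then obtain M where q: "q = total_weight M"
      and M: "M \<in> {indicator_graph V E} \<star> map_weights of_Zy ` C_fam n \<star> {R_poly n}"
      by (rule imageE)
    obtain N g where N: "N \<in> {indicator_graph V E} \<star> map_weights of_Zy ` C_fam n"
      and g: "bij_betw g (verts N) {1..n}" "M = wprod_by g N (R_poly n)"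
      using M unfolding mem_fam_prod_iff[of M] by (auto simp: verts_simps)
    obtain H h where H: "H \<in> C_fam n" "bij_betw h V (verts H)"
      and "N = wprod_by h (indicator_graph V E) (map_weights of_Zy H)"
      using N unfolding mem_fam_prod_iff[of N] by (auto simp: verts_simps)
    with q g show "\<exists>H\<in>C_fam n. \<exists>h g. bij_betw h V (verts H) \<and> bij_betw g V {1..n} \<and>
      q = total_weight
        (wprod_by g (wprod_by h (indicator_graph V E) (map_weights of_Zy H)) (R_poly n))"
      by (auto simp: verts_simps)
  next
    assume "\<exists>H\<in>C_fam n. \<exists>h g. bij_betw h V (verts H) \<and> bij_betw g V {1..n} \<and>
      q = total_weight
        (wprod_by g (wprod_by h (indicator_graph V E) (map_weights of_Zy H)) (R_poly n))"
    then obtain H h g where H: "H \<in> C_fam n" "bij_betw h V (verts H)" "bij_betw g V {1..n}"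
      and q: "q = total_weight
        (wprod_by g (wprod_by h (indicator_graph V E) (map_weights of_Zy H)) (R_poly n))"
      by blast
    have "wprod_by h (indicator_graph V E) (map_weights of_Zy H)
        \<in> {indicator_graph V E} \<star> map_weights of_Zy ` C_fam n"
      by (rule mem_fam_prodI) (simp_all add: verts_simps H)
    then have "wprod_by g (wprod_by h (indicator_graph V E) (map_weights of_Zy H)) (R_poly n)
        \<in> {indicator_graph V E} \<star> map_weights of_Zy ` C_fam n \<star> {R_poly n}"
      by (rule mem_fam_prodI) (use H(3) in \<open>simp_all add: verts_simps\<close>)
    then show "q \<in> ?L" unfolding q by (rule imageI)
  qed
  have tw: "total_weight (wprod_by g (wprod_by h (indicator_graph V E) (map_weights of_Zy H)) (R_poly n))
      = (\<Sum>e\<in>E. of_Zy (weight H (h ` e)) * weight (R_poly n) (g ` e))"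
    for g :: "'a \<Rightarrow> nat" and h :: "'a \<Rightarrow> nat" and H
    unfolding total_weight_def wprod_by_def indicator_graph_def map_weights_def
    by (rule sum.mono_neutral_cong_right)
      (use fin sub in \<open>auto simp: finite_imp_finite_nsets\<close>)
  show ?thesis
  proof (intro equalityI subsetI)
    fix q assume "q \<in> ?L"
    then obtain g h H where g: "bij_betw g V {1..n}" and H: "H \<in> C_fam n"
      and h: "bij_betw h V (verts H)"
      and q: "q = (\<Sum>e\<in>E. of_Zy (weight H (h ` e)) * weight (R_poly n) (g ` e))"
      unfolding L tw by blast
    have "\<forall>e\<in>E. \<exists>m\<in>{0, 1, 2}. weight H (h ` e) = label_poly m"
      using H h sub bij_betw_nsets_image[OF h, of _ 2] label_poly_surj
      unfolding C_fam_iff[OF assms(3)] by blast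
    then obtain f where "\<forall>e\<in>E. f e \<in> {0, 1, 2} \<and> weight H (h ` e) = label_poly (f e)"
      by metis
    then show "q \<in> ?R" using g q by (auto simp: label_sum_def intro!: exI sum.cong)
  next
    fix q assume "q \<in> ?R"
    then obtain g f where g: "bij_betw g V {1..n}" and f: "f ` E \<subseteq> {0, 1, 2}"
      and q: "q = label_sum E n g f" by auto
    define H where "H = WGraph {1..n}
      (\<lambda>d. if d \<in> [{1..n}]\<^bsup>2\<^esup> then label_poly (f (inv_into V g ` d)) else 0)"
    have "H \<in> C_fam n"
      unfolding C_fam_iff[OF assms(3)] using label_poly_mem
      by (auto simp: H_def weighted_complete_graph_def)
    moreover have "weight H (g ` e) = label_poly (f e)" if "e \<in> E" for e
    proof -
      have e: "e \<in> [V]\<^bsup>2\<^esup>" using that sub by auto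
      moreover have "inv_into V g ` g ` e = e"
        using e g by (intro inv_into_image_cancel) (auto simp: bij_betw_def nsets_def)
      ultimately show ?thesis
        using bij_betw_nsets_image[OF g e] by (simp add: H_def)
    qed
    then have "q = (\<Sum>e\<in>E. of_Zy (weight H (g ` e)) * weight (R_poly n) (g ` e))"
      by (simp add: q label_sum_def)
    moreover have "bij_betw g V (verts H)" using g by (simp add: H_def)
    ultimately show "q \<in> ?L" unfolding L tw using g by blast
  qed
qed

section \<open>The weight of a labelling\<close>

lemma weight_R_poly:
  "weight (R_poly n) d =
    (\<Sum>(j, k)\<in>ordered_pairs n. monom 1 (pair_index k j) * of_C (weight (R_graph n j k) d))"
  by (simp add: R_poly_def wsum_def wscale_def map_weights_def ordered_pairs_def case_prod_unfold)

lemma eval11_mult: "eval11 (p * q) = eval11 p * eval11 q"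
  by (simp add: eval11_def)

lemma eval11_sum: "eval11 (\<Sum>a\<in>A. F a) = (\<Sum>a\<in>A. eval11 (F a))"
  by (simp add: eval11_def poly_sum)

lemma eval11_monom_of_C: "eval11 (monom 1 m * of_C c) = c"
  by (simp add: eval11_def of_C_def poly_monom)

lemma eval11_of_Zy: "eval11 (of_Zy p) = of_int (poly p 1)"
  by (simp add: eval11_def of_Zy_def poly_altdef degree_map_poly coeff_map_poly)

text \<open>
  At $x=1$ all graphs $R(j,k)$ are simply added. Since the weight of $R(j,k)$ at a pair is symmetric
  in the two pairs, the sum over all \<open>{j, k}\<close> is a count of the pairs adjacent to \<open>d\<close>, plus \<open>\<i>\<close> for \<open>d\<close>
  itself.
\<close>

lemma eval11_R_poly:
  assumes "2 \<le> n" "d \<in> [{1..n}]\<^bsup>2\<^esup>"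
  shows "eval11 (weight (R_poly n) d) = 2 * of_nat n - 4 + \<i>"
proof -
  define w :: "nat set \<Rightarrow> complex" where
    "w b = (if b = d then \<i> else if card (b \<inter> d) = 1 then 1 else 0)" for b
  have "eval11 (weight (R_poly n) d) = (\<Sum>(j, k)\<in>ordered_pairs n. weight (R_graph n j k) d)"
    by (simp add: weight_R_poly eval11_sum eval11_monom_of_C case_prod_unfold)
  also have "\<dots> = (\<Sum>b\<in>[{1..n}]\<^bsup>2\<^esup>. w b)"
  proof -
    have "weight (R_graph n j k) d = w {j, k}" for j k
      using assms(2) by (simp add: R_graph_def w_def eq_commute[of d])
    then have "(\<Sum>(j, k)\<in>ordered_pairs n. weight (R_graph n j k) d)
        = (\<Sum>p\<in>ordered_pairs n. w (case p of (j, k) \<Rightarrow> {j, k}))"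
      by (simp add: case_prod_unfold)
    also have "\<dots> = (\<Sum>b\<in>[{1..n}]\<^bsup>2\<^esup>. w b)"
      by (rule sum.reindex_bij_betw[OF bij_betw_ordered_pairs])
    finally show ?thesis .
  qed
  also have "\<dots> = w d + (\<Sum>b\<in>[{1..n}]\<^bsup>2\<^esup> - {d}. w b)"
    using assms(2) by (intro sum.remove) (auto simp: finite_imp_finite_nsets)
  also have "(\<Sum>b\<in>[{1..n}]\<^bsup>2\<^esup> - {d}. w b) = (\<Sum>b\<in>{b \<in> [{1..n}]\<^bsup>2\<^esup>. card (b \<inter> d) = 1}. 1)"
    using assms(2) by (intro sum.mono_neutral_cong_right)
      (auto simp: w_def finite_imp_finite_nsets nsets_def)
  also have "\<dots> = of_nat (2 * (n - 2))"
    using card_pairs_meeting_once[OF _ assms(2)] by simp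
  also have "w d + \<dots> = 2 * of_nat n - 4 + \<i>"
    using assms(1) by (simp add: w_def of_nat_diff)
  finally show ?thesis .
qed

text \<open>
  All edges contribute the same factor, so the quotient is the sum of $f(e)-1$ over the edges.
\<close>

lemma card_plus_eval11_label_sum:
  assumes "2 \<le> n" "finite E" "E \<subseteq> [V]\<^bsup>2\<^esup>" "bij_betw g V {1..n}" "f ` E \<subseteq> {0, 1, 2}"
  shows "of_nat (card E) + eval11 (label_sum E n g f) / (2 * of_nat n - 4 + \<i>)
    = of_nat (\<Sum>e\<in>E. f e)"
proof -
  let ?D = "2 * of_nat n - 4 + \<i> :: complex"
  \<comment> \<open>The imaginary part keeps the divisor nonzero even for \<open>n = 2\<close>.\<close>
  have "Im ?D = 1" by simp
  then have D: "?D \<noteq> 0" by (metis zero_complex.simps(2) zero_neq_one)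
  have "eval11 (label_sum E n g f) = (\<Sum>e\<in>E. (of_nat (f e) - 1) * ?D)"
    unfolding label_sum_def eval11_sum
  proof (rule sum.cong)
    fix e assume "e \<in> E"
    then have "f e \<in> {0, 1, 2}" "g ` e \<in> [{1..n}]\<^bsup>2\<^esup>"
      using assms(3,5) bij_betw_nsets_image[OF assms(4)] by auto
    then show "eval11 (of_Zy (label_poly (f e)) * weight (R_poly n) (g ` e))
        = (of_nat (f e) - 1) * ?D"
      by (simp only: eval11_mult eval11_of_Zy eval11_R_poly[OF assms(1)] poly_label_poly_1) simp
  qed simp
  also have "\<dots> = (of_nat (\<Sum>e\<in>E. f e) - of_nat (card E)) * ?D"
    by (simp add: sum_distrib_right[symmetric] sum_subtractf)
  finally show ?thesis using D by simp
qed

section \<open>The domination condition\<close>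

lemma coeff_weight_R_poly:
  assumes "(j, k) \<in> ordered_pairs n"
  shows "coeff (weight (R_poly n) d) (pair_index k j) = [:weight (R_graph n j k) d:]"
proof -
  have inj: "pair_index k' j' = pair_index k j \<longleftrightarrow> (j', k') = (j, k)"
    if "(j', k') \<in> ordered_pairs n" for j' k'
    using bij_betw_pair_index[of n] assms that by (auto simp: bij_betw_def inj_on_def)
  have "coeff (weight (R_poly n) d) (pair_index k j) =
    (\<Sum>p\<in>ordered_pairs n. if p = (j, k) then [:weight (R_graph n j k) d:] else 0)"
    unfolding weight_R_poly coeff_sum
    by (rule sum.cong) (auto simp: of_C_def inj split: if_splits)
  then show ?thesis using assms finite_ordered_pairs by simp
qed

text \<open>
  By injectivity of the pair index only $R(j,k)$ contributes to this coefficient. Pulled back along \<open>g\<close>,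
  its weights are expressed by adjacency to the pair \<open>b\<close> of vertices of the graph.
\<close>

lemma coeff_label_sum:
  assumes "E \<subseteq> [V]\<^bsup>2\<^esup>" "bij_betw g V {1..n}"
    and "b \<in> [V]\<^bsup>2\<^esup>" "(j, k) \<in> ordered_pairs n" "g ` b = {j, k}"
  shows "coeff (label_sum E n g f) (pair_index k j) =
    (\<Sum>e\<in>E. smult (if e = b then \<i> else if adjacent_edges b e then 1 else 0)
      (map_poly of_int (label_poly (f e))))"
  unfolding label_sum_def coeff_sum
proof (rule sum.cong)
  fix e assume "e \<in> E"
  then have e: "e \<in> [V]\<^bsup>2\<^esup>" using assms(1) by auto
  have inj: "inj_on g V" using assms(2) by (simp add: bij_betw_def)
  have subs: "e \<subseteq> V" "b \<subseteq> V" using e assms(3) by (auto simp: nsets_def)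
  have "g ` e = {j, k} \<longleftrightarrow> e = b"
    using inj subs inj_on_image_eq_iff[of g V e b] assms(5) by auto
  moreover have "card ({j, k} \<inter> g ` e) = card (b \<inter> e)"
  proof -
    have "{j, k} \<inter> g ` e = g ` (b \<inter> e)"
      using inj_on_image_Int[OF inj subs(2,1)] assms(5) by simp
    then show ?thesis using inj subs by (metis card_image inj_on_subset le_infI1)
  qed
  moreover have "g ` e \<in> [{1..n}]\<^bsup>2\<^esup>" using bij_betw_nsets_image[OF assms(2) e] .
  ultimately have "weight (R_graph n j k) (g ` e)
      = (if e = b then \<i> else if adjacent_edges b e then 1 else 0)"
    by (simp add: R_graph_def adjacent_edges_def)
  then show "coeff (of_Zy (label_poly (f e)) * weight (R_poly n) (g ` e)) (pair_index k j) =
      smult (if e = b then \<i> else if adjacent_edges b e then 1 else 0)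
      (map_poly of_int (label_poly (f e)))"
    by (simp add: of_Zy_def coeff_weight_R_poly[OF assms(4)])
qed simp

lemma coeff_of_int_label_poly:
  "coeff (map_poly of_int (label_poly m) :: complex poly) 0 = (if m = 0 then -1 else 0)"
  "coeff (map_poly of_int (label_poly m) :: complex poly) (Suc 0) = (if m = 2 then 1 else 0)"
  "2 \<le> i \<Longrightarrow> coeff (map_poly of_int (label_poly m) :: complex poly) i = 0"
  by (auto simp: coeff_map_poly label_poly_def coeff_pCons split: nat.splits)

text \<open>
  The coefficient of \<open>y\<close> is listed apart from the higher ones because the weights have degree at
  most one: it alone decides, next to the constant term, about the sums considered here.
\<close>

lemma mem_minus_i_plus_Z_iff:
  "p \<in> minus_i_plus_Z \<longleftrightarrow>
    coeff p 0 + \<i> \<in> \<int> \<and> coeff p (Suc 0) = 0 \<and> (\<forall>i\<ge>2. coeff p i = 0)"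
proof
  assume "p \<in> minus_i_plus_Z"
  then show "coeff p 0 + \<i> \<in> \<int> \<and> coeff p (Suc 0) = 0 \<and> (\<forall>i\<ge>2. coeff p i = 0)"
    by (auto simp: minus_i_plus_Z_def coeff_pCons split: nat.splits)
next
  assume *: "coeff p 0 + \<i> \<in> \<int> \<and> coeff p (Suc 0) = 0 \<and> (\<forall>i\<ge>2. coeff p i = 0)"
  then obtain m where "coeff p 0 + \<i> = of_int m" by (auto elim: Ints_cases)
  then have "coeff p 0 = of_int m - \<i>" by (simp only: eq_diff_eq)
  then have "coeff p 0 = - \<i> + of_int m" by simp
  moreover have "coeff p i = 0" if "0 < i" for i
    using that * by (cases "i = Suc 0") auto
  ultimately have "p = [:- \<i> + of_int m:]"
    by (intro poly_eqI) (auto simp: coeff_pCons split: nat.splits)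
  then show "p \<in> minus_i_plus_Z" by (auto simp: minus_i_plus_Z_def)
qed

text \<open>
  An imaginary contribution to the constant term comes from \<open>b\<close> alone, and only if its label is $0$;
  the adjacent edges change the constant term by integers. If \<open>b\<close> has label $0$, then the
  coefficient of \<open>y\<close> comes from adjacent edges alone. It is a sum of ones, so no cancellation can
  hide an adjacent edge of label $2$.
\<close>

lemma label_combination_mem_iff:
  fixes b :: "'v set" and f :: "'v set \<Rightarrow> nat"
  assumes "finite E"
  defines "P \<equiv> (\<Sum>e\<in>E. smult (if e = b then \<i> else if adjacent_edges b e then 1 else 0)
      (map_poly of_int (label_poly (f e))))"
  shows "P \<in> minus_i_plus_Z \<longleftrightarrow>
    b \<in> E \<and> f b = 0 \<and> \<not> (\<exists>e\<in>E. adjacent_edges b e \<and> f e = 2)"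
proof -
  define T where "T = {e \<in> E. e \<noteq> b \<and> adjacent_edges b e \<and> f e = 2}"
  define Z where "Z = {e \<in> E. e \<noteq> b \<and> adjacent_edges b e \<and> f e = 0}"
  have split: "(\<Sum>e\<in>E. h e) = (if b \<in> E then h b else 0) + (\<Sum>e\<in>E - {b}. h e)"
    for h :: "'v set \<Rightarrow> complex"
    using assms(1) by (auto simp: sum.remove)
  have c0: "coeff P 0 = (if b \<in> E \<and> f b = 0 then - \<i> else 0) - of_nat (card Z)"
  proof -
    have "coeff P 0 = (if b \<in> E \<and> f b = 0 then - \<i> else 0) + (\<Sum>e\<in>E - {b}. if e \<in> Z then - 1 else 0)"
      unfolding P_def coeff_sum coeff_smult coeff_of_int_label_poly split
      by (intro arg_cong2[of _ _ _ _ "(+)"] sum.cong) (auto simp: Z_def)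
    also have "(\<Sum>e\<in>E - {b}. if e \<in> Z then - 1 else 0) = (\<Sum>e\<in>Z. - 1 :: complex)"
      using assms(1) by (intro sum.mono_neutral_cong_right) (auto simp: Z_def)
    finally show ?thesis by simp
  qed
  have c1: "coeff P (Suc 0) = (if b \<in> E \<and> f b = 2 then \<i> else 0) + of_nat (card T)"
  proof -
    have "coeff P (Suc 0) = (if b \<in> E \<and> f b = 2 then \<i> else 0) + (\<Sum>e\<in>E - {b}. if e \<in> T then 1 else 0)"
      unfolding P_def coeff_sum coeff_smult coeff_of_int_label_poly split
      by (intro arg_cong2[of _ _ _ _ "(+)"] sum.cong) (auto simp: T_def)
    also have "(\<Sum>e\<in>E - {b}. if e \<in> T then 1 else 0) = (\<Sum>e\<in>T. 1 :: complex)"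
      using assms(1) by (intro sum.mono_neutral_cong_right) (auto simp: T_def)
    finally show ?thesis by simp
  qed
  have c2: "coeff P i = 0" if "2 \<le> i" for i
    using that by (simp add: P_def coeff_sum coeff_of_int_label_poly)
  have "coeff P 0 + \<i> \<in> \<int> \<longleftrightarrow> b \<in> E \<and> f b = 0"
  proof
    assume "coeff P 0 + \<i> \<in> \<int>"
    then have "Im (coeff P 0 + \<i>) = 0" by (metis Ints_cases complex_Im_of_int)
    then show "b \<in> E \<and> f b = 0" by (auto simp: c0 split: if_splits)
  qed (simp add: c0)
  moreover have "coeff P (Suc 0) = 0 \<longleftrightarrow> T = {}" if "f b = 0"
    using that assms(1) by (simp add: c1 T_def)
  moreover have "T = {} \<longleftrightarrow> \<not> (\<exists>e\<in>E. adjacent_edges b e \<and> f e = 2)" if "f b = 0"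
    using that by (auto simp: T_def)
  ultimately show ?thesis
    using c2 unfolding mem_minus_i_plus_Z_iff by blast
qed

text \<open>
  The exponents up to $\binom n2-1$ are exactly the indices of pairs of vertices. A pair that is
  not an edge never gives a coefficient in $-i+\mathbb{Z}$, so only the edges impose a condition.
\<close>

lemma label_sum_coeffs_iff_edge_roman_dom:
  assumes "2 \<le> n" "finite E" "E \<subseteq> [V]\<^bsup>2\<^esup>" "bij_betw g V {1..n}" "f ` E \<subseteq> {0, 1, 2}"
  shows "(\<forall>j\<in>{0..(n choose 2) - 1}. coeff (label_sum E n g f) j \<notin> minus_i_plus_Z)
    \<longleftrightarrow> edge_roman_dom E f"
proof -
  have good: "coeff (label_sum E n g f) (pair_index k j) \<notin> minus_i_plus_Z \<longleftrightarrow>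
      (b \<in> E \<longrightarrow> f b = 0 \<longrightarrow> (\<exists>e\<in>E. adjacent_edges b e \<and> f e = 2))"
    if "b \<in> [V]\<^bsup>2\<^esup>" "(j, k) \<in> ordered_pairs n" "g ` b = {j, k}" for b j k
    unfolding coeff_label_sum[OF assms(3,4) that] label_combination_mem_iff[OF assms(2)] by blast
  have "0 < n choose 2" using assms(1) by (rule zero_less_binomial)
  moreover have "{0..m - 1} = {..<m}" if "0 < m" for m :: nat
    using that by auto
  ultimately have "{0..(n choose 2) - 1} = {..<n choose 2}" by blast
  also have "\<dots> = (\<lambda>(j, k). pair_index k j) ` ordered_pairs n"
    by (rule bij_betw_imp_surj_on[OF bij_betw_pair_index, symmetric])
  finally have range: "{0..(n choose 2) - 1} = (\<lambda>(j, k). pair_index k j) ` ordered_pairs n" .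
  have all_indices: "(\<forall>j\<in>{0..(n choose 2) - 1}. P j) \<longleftrightarrow> (\<forall>(j, k)\<in>ordered_pairs n. P (pair_index k j))"
    for P
    unfolding range ball_simps(9) by (rule ball_cong[OF refl]) (rule prod.case_distrib)
  have "(\<forall>j\<in>{0..(n choose 2) - 1}. coeff (label_sum E n g f) j \<notin> minus_i_plus_Z) \<longleftrightarrow>
      (\<forall>(j, k)\<in>ordered_pairs n. coeff (label_sum E n g f) (pair_index k j) \<notin> minus_i_plus_Z)"
    by (rule all_indices[of "\<lambda>i. coeff (label_sum E n g f) i \<notin> minus_i_plus_Z"])
  also have "\<dots> \<longleftrightarrow> (\<forall>b\<in>[V]\<^bsup>2\<^esup>. b \<in> E \<longrightarrow> f b = 0 \<longrightarrow> (\<exists>e\<in>E. adjacent_edges b e \<and> f e = 2))"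
  proof (intro iffI ballI)
    fix b assume l: "\<forall>(j, k)\<in>ordered_pairs n.
        coeff (label_sum E n g f) (pair_index k j) \<notin> minus_i_plus_Z" and b: "b \<in> [V]\<^bsup>2\<^esup>"
    have "g ` b \<in> (\<lambda>(j, k). {j, k}) ` ordered_pairs n"
      unfolding bij_betw_imp_surj_on[OF bij_betw_ordered_pairs]
      by (rule bij_betw_nsets_image[OF assms(4) b])
    then obtain p where "p \<in> ordered_pairs n" "g ` b = (case p of (j, k) \<Rightarrow> {j, k})"
      by (rule imageE)
    then obtain j k where jk: "(j, k) \<in> ordered_pairs n" "g ` b = {j, k}"
      by (cases p) simp
    have "coeff (label_sum E n g f) (pair_index k j) \<notin> minus_i_plus_Z"
      using bspec[OF l jk(1)] by simp
    then show "b \<in> E \<longrightarrow> f b = 0 \<longrightarrow> (\<exists>e\<in>E. adjacent_edges b e \<and> f e = 2)"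
      by (rule iffD1[OF good[OF b jk]])
  next
    fix p assume r: "\<forall>b\<in>[V]\<^bsup>2\<^esup>. b \<in> E \<longrightarrow> f b = 0 \<longrightarrow>
        (\<exists>e\<in>E. adjacent_edges b e \<and> f e = 2)" and p: "p \<in> ordered_pairs n"
    obtain j k where jk: "p = (j, k)" by (cases p)
    have "{j, k} \<in> [{1..n}]\<^bsup>2\<^esup>"
      using bij_betw_apply[OF bij_betw_ordered_pairs p] by (simp add: jk)
    then obtain b where b: "b \<in> [V]\<^bsup>2\<^esup>" "g ` b = {j, k}"
      using bij_betw_imp_surj_on[OF bij_betw_nsets[OF assms(4), of 2]] by (metis imageE)
    then show "case p of (j, k) \<Rightarrow> coeff (label_sum E n g f) (pair_index k j) \<notin> minus_i_plus_Z"
      using good[OF b(1) _ b(2)] bspec[OF r b(1)] p by (simp add: jk)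
  qed
  also have "\<dots> \<longleftrightarrow> edge_roman_dom E f"
  proof -
    have "(\<forall>b\<in>[V]\<^bsup>2\<^esup>. b \<in> E \<longrightarrow> Q b) \<longleftrightarrow> (\<forall>b\<in>E. Q b)" for Q
      using assms(3) by blast
    then show ?thesis by (simp only: edge_roman_dom_def assms(5) simp_thms)
  qed
  finally show ?thesis .
qed

section \<open>The edge Roman domination number\<close>

text \<open>
  The constant labelling $1$ is edge Roman dominating, so the least weight is attained.
\<close>

lemma edge_roman_number_le_iff:
  "int (edge_roman_number E) \<le> k \<longleftrightarrow>
    (\<exists>f. edge_roman_dom E f \<and> int (\<Sum>e\<in>E. f e) \<le> k)"
proof
  let ?P = "\<lambda>w. \<exists>f. edge_roman_dom E f \<and> w = (\<Sum>e\<in>E. f e)"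
  have "edge_roman_dom E (\<lambda>_. 1)" by (simp add: edge_roman_dom_def image_subset_iff)
  then have "?P (edge_roman_number E)"
    unfolding edge_roman_number_def by (intro LeastI_ex[of ?P]) blast
  then show "\<exists>f. edge_roman_dom E f \<and> int (\<Sum>e\<in>E. f e) \<le> k" if "int (edge_roman_number E) \<le> k"
    using that by auto
  show "int (edge_roman_number E) \<le> k" if "\<exists>f. edge_roman_dom E f \<and> int (\<Sum>e\<in>E. f e) \<le> k"
  proof -
    from that obtain f where f: "edge_roman_dom E f" "int (\<Sum>e\<in>E. f e) \<le> k" by blast
    then have "edge_roman_number E \<le> (\<Sum>e\<in>E. f e)"
      unfolding edge_roman_number_def by (intro Least_le[of ?P]) blast
    then show ?thesis using f(2) by linarith
  qed
qed

lemma complex_le_of_nat: "complex_le (of_nat m) k \<longleftrightarrow> int m \<le> k"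
proof -
  have "real m \<le> real_of_int k \<longleftrightarrow> int m \<le> k" by linarith
  then show ?thesis by (simp add: complex_le_def)
qed

theorem theorem3p11:
  fixes V :: "'v set" and E :: "'v set set" and n :: nat and k :: int
  assumes "simple_graph V E"
    and "n = card V" and "n \<ge> 2"
    and "k < int (card E)"
  shows "int (edge_roman_number E) \<le> k \<longleftrightarrow>
    (\<exists>p \<in> {q \<in> total_weight ` ({indicator_graph V E} \<star> map_weights of_Zy ` C_fam n \<star> {R_poly n}).
            complex_le (of_nat (card E) + eval11 q / (2 * of_nat n - 4 + \<i>)) k}.
       \<forall>j \<in> {0..(n choose 2) - 1}. coeff p j \<notin> minus_i_plus_Z)"
proof -
  have fin: "finite V" and sub: "E \<subseteq> [V]\<^bsup>2\<^esup>"
    using assms(1) by (auto simp: simple_graph_def)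
  have finE: "finite E"
    by (rule finite_subset[OF sub finite_imp_finite_nsets[OF fin]])
  obtain g0 where g0: "bij_betw g0 V {1..n}"
    using finite_same_card_bij[OF fin finite_atLeastAtMost, of 1 n] assms(2)
    by (metis card_atLeastAtMost add_diff_cancel_right' Suc_eq_plus1)
  have iff: "complex_le (of_nat (card E) + eval11 (label_sum E n g f) / (2 * of_nat n - 4 + \<i>)) k
        \<and> (\<forall>j \<in> {0..(n choose 2) - 1}. coeff (label_sum E n g f) j \<notin> minus_i_plus_Z)
      \<longleftrightarrow> int (\<Sum>e\<in>E. f e) \<le> k \<and> edge_roman_dom E f"
    if "bij_betw g V {1..n}" "f ` E \<subseteq> {0, 1, 2}" for g f
    unfolding card_plus_eval11_label_sum[OF assms(3) finE sub that]
      label_sum_coeffs_iff_edge_roman_dom[OF assms(3) finE sub that] complex_le_of_nat ..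
  have "(\<exists>p \<in> {q \<in> total_weight ` ({indicator_graph V E} \<star> map_weights of_Zy ` C_fam n \<star> {R_poly n}).
            complex_le (of_nat (card E) + eval11 q / (2 * of_nat n - 4 + \<i>)) k}.
       \<forall>j \<in> {0..(n choose 2) - 1}. coeff p j \<notin> minus_i_plus_Z)
    \<longleftrightarrow> (\<exists>g f. bij_betw g V {1..n} \<and> f ` E \<subseteq> {0, 1, 2} \<and>
          (complex_le (of_nat (card E) + eval11 (label_sum E n g f) / (2 * of_nat n - 4 + \<i>)) k
          \<and> (\<forall>j \<in> {0..(n choose 2) - 1}. coeff (label_sum E n g f) j \<notin> minus_i_plus_Z)))"
  proof -
    have "(\<exists>p\<in>{q \<in> {h g f | g f. A g \<and> B f}. X q}. Y p) \<longleftrightarrow>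
        (\<exists>g f. A g \<and> B f \<and> X (h g f) \<and> Y (h g f))"
      for A B and X Y :: "complex poly poly \<Rightarrow> bool"
        and h :: "('v \<Rightarrow> nat) \<Rightarrow> ('v set \<Rightarrow> nat) \<Rightarrow> complex poly poly"
      by blast
    then show ?thesis unfolding total_weight_family[OF assms(1-3)] .
  qed
  also have "\<dots> \<longleftrightarrow> (\<exists>g f. bij_betw g V {1..n} \<and> f ` E \<subseteq> {0, 1, 2} \<and>
      (int (\<Sum>e\<in>E. f e) \<le> k \<and> edge_roman_dom E f))"
    by (simp only: iff cong: conj_cong)
  also have "\<dots> \<longleftrightarrow> (\<exists>f. f ` E \<subseteq> {0, 1, 2} \<and> int (\<Sum>e\<in>E. f e) \<le> k \<and> edge_roman_dom E f)"
    \<comment> \<open>The two conditions on the labelling do not mention \<open>g\<close>, so one bijection suffices.\<close>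
    using g0 by blast
  also have "\<dots> \<longleftrightarrow> int (edge_roman_number E) \<le> k"
    unfolding edge_roman_number_le_iff by (auto simp: edge_roman_dom_def)
  finally show ?thesis by simp
qed

end
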